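(* Assume the enhanced-tail same-gauge selector: for every intrinsic package $\mathcal D$ a representative $\zeta_\ast(\mathcal D)\in\Gamma_\Lambda^{\mathrm{int}}$ is fixed, $\mathcal D_\ast:=\mathcal D-\zeta_\ast(\mathcal D)$, and there is $\delta_{\mathrm{sel}}^\sharp\ge0$ such that for all $\mathcal D$ $$\|\mathcal D_\ast\|_{\mathrm{loc,int}}+\alpha_{\mathrm{proj}}\mathcal T_{\mathrm{proj}}(\mathcal D;\zeta_\ast)+\alpha_{\mathrm{harm}}\mathcal T_{\mathrm{harm}}(\mathcal D;\zeta_\ast)\le\operatorname{dist}^{\sharp,\mathrm{tail}}(\mathcal D)+\delta_{\mathrm{sel}}^\sharp.$$ For $a\in\{\mathrm{en},\mathrm{flux},\mathrm{prs},\mathrm{mom}\}$ let $K_{\mathrm{loc}}^a:\mathfrak I_\Lambda^{\mathrm{loc}}\to Y_{\mathrm{loc}}^a$ be bounded linear operators into finite-dimensional normed spaces, with operator norms $C_{\mathrm{loc}}^a$, and define the localization leakage residual $\mathcal R_{\mathrm{loc}}(\mathcal D)=\sum_a\|K_{\mathrm{loc}}^a\mathcal D_\ast\|_{Y_{\mathrm{loc}}^a}$. Set $C_{\mathrm{loc}}=C_{\mathrm{loc}}^{\mathrm{en}}+C_{\mathrm{loc}}^{\mathrm{flux}}+C_{\mathrm{loc}}^{\mathrm{prs}}+C_{\mathrm{loc}}^{\mathrm{mom}}$. Then for every intrinsic package $\mathcal D$, $$\mathcal R_{\mathrm{loc}}(\mathcal D)\le C_{\mathrm{loc}}\operatorname{dist}^{\sharp,\mathrm{tail}}(\mathcal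 D)+C_{\mathrm{loc}}\delta_{\mathrm{sel}}^\sharp,$$ i.e. $\mathcal R_{\mathrm{loc}}(\mathcal D)\le\eta_{\mathrm{loc}}\operatorname{dist}^{\sharp,\mathrm{tail}}(\mathcal D)+\Delta_{\mathrm{loc}}$ with $\eta_{\mathrm{loc}}=C_{\mathrm{loc}}$ and $\Delta_{\mathrm{loc}}=C_{\mathrm{loc}}\delta_{\mathrm{sel}}^\sharp$. If the selector is an exact enhanced-tail minimizer, then one may take $\delta_{\mathrm{sel}}^\sharp=0$ and $\Delta_{\mathrm{loc}}=0$.
   Context: Intrinsic packages. $\Lambda$ is a finite set of consecutive integers. For $k\in\Lambda$, $j=1,\dots,7$, let $X_k^{(j)}$ be normed spaces; an intrinsic package is $\mathcal D=(x_k^{(j)})_{k,j}$, $x_k^{(j)}\in X_k^{(j)}$, with norm $\|\mathcal D\|_{\mathrm{loc,int}}^2=\sum_{k}\sum_{j}a_j\|x_k^{(j)}\|^2$, $a_j>0$ fixed; $\mathfrak I_\Lambda^{\mathrm{loc}}$ is the space of intrinsic packages with this norm and $\Gamma_\Lambda^{\mathrm{int}}\subset\mathfrak I_\Lambda^{\mathrm{loc}}$ a linear subspace. Enhanced-tail distance. Let $B_r\subset\mathbb R^3$ be the ball of radius $r$ about $0$, $I=(-1,0)$, $Y_{\mathrm{prs}}=L^{3/2}(I;L^{3/2}(B_{1/2}))$, and $\mathsf R_i$ the Riesz transforms on $\mathbb R^3$ (tensors on $B_1$ are extended by zero, repeated indices summed, results restricted to $B_{1/2}$). Each package $\mathcal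 D$ carries a clean source tensor $F^{\mathrm{cl}}_{ij}(\mathcal D)=U_iU_j+R_{ij}\in L^{3/2}(I;L^{3/2}(B_1))$ built from its clean velocity and covariance coordinates $U,R$, and a harmonic pressure component $p_{\mathrm{harm}}(\mathcal D)$ in a normed space $Y_{\mathrm{harm}}$. $P_{\mathrm{prs},N}^{\mathrm{cl}}$ is a bounded linear projection on $Y_{\mathrm{prs}}$, $\Pi_{\mathrm{harm},M}$ a bounded projection of $Y_{\mathrm{harm}}$ onto a finite-dimensional subspace, $J_{\mathrm{harm}}:Y_{\mathrm{harm}}\to Y_{\mathrm{prs}}$ bounded linear. For $\zeta\in\Gamma_\Lambda^{\mathrm{int}}$, $\mathcal T_{\mathrm{proj}}(\mathcal D;\zeta)=(1+\|P_{\mathrm{prs},N}^{\mathrm{cl}}\|)\|\mathsf R_i\mathsf R_jF_{ij}^{\mathrm{cl}}(\mathcal D-\zeta)\|_{Y_{\mathrm{prs}}}$, $\mathcal T_{\mathrm{harm}}(\mathcal D;\zeta)=\|J_{\mathrm{harm}}\|\,\|(I-\Pi_{\mathrm{harm},M})p_{\mathrm{harm}}(\mathcal D-\zeta)\|_{Y_{\mathrm{harm}}}$. For fixed $\alpha_{\mathrm{proj}},\alpha_{\mathrm{harm}}>0$, $$\operatorname{dist}^{\sharp,\mathrm{tail}}(\mathcal D)=\inf_{\zeta\in\Gamma_\Lambda^{\mathrm{int}}}\big(\|\mathcal D-\zeta\|_{\mathrm{loc,int}}+\alpha_{\mathrm{proj}}\mathcal T_{\mathrm{proj}}(\mathcal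 D;\zeta)+\alpha_{\mathrm{harm}}\mathcal T_{\mathrm{harm}}(\mathcal D;\zeta)\big).$$ *)

theory Defs
  imports "HOL-Analysis.Analysis" "HOL-Library.Function_Algebras"
begin

instantiation "fun" :: (type, real_vector) real_vector
begin

definition "scaleR c (f :: 'a \<Rightarrow> 'b) = (\<lambda>x. c *\<^sub>R f x)"

instance
  by standard (auto simp: scaleR_fun_def plus_fun_def scaleR_add_right scaleR_add_left)

end


section \<open>Intrinsic packages\<close>

text \<open>
  The spaces \<open>X k j\<close> are linear subspaces of one ambient normed space; this costs no
  generality, since any family of normed spaces embeds isometrically in its
  (finitely supported) direct sum. A package is a family indexed by
  \<open>k \<in> \<Lambda>\<close>, \<open>j = 1,\<dots>,7\<close>, stored as a function that vanishes at all other indices.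
\<close>

type_synonym 'v pkg = "int \<Rightarrow> nat \<Rightarrow> 'v"

definition packages :: "int set \<Rightarrow> (int \<Rightarrow> nat \<Rightarrow> 'v::real_normed_vector set) \<Rightarrow> 'v pkg set" where
  "packages \<Lambda> X = {D. (\<forall>k\<in>\<Lambda>. \<forall>j\<in>{1..7}. D k j \<in> X k j) \<and>
                      (\<forall>k j. \<not> (k \<in> \<Lambda> \<and> j \<in> {1..7}) \<longrightarrow> D k j = 0)}"

definition loc_int_norm :: "int set \<Rightarrow> (nat \<Rightarrow> real) \<Rightarrow> 'v::real_normed_vector pkg \<Rightarrow> real" where
  "loc_int_norm \<Lambda> a D = sqrt (\<Sum>k\<in>\<Lambda>. \<Sum>j = 1..7. a j * (norm (D k j))\<^sup>2)"

text \<open>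
  Counterparts of \<^const>\<open>bounded_linear\<close> and \<^const>\<open>onorm\<close> for an operator whose domain is a
  linear subspace \<open>V\<close> carrying its own norm \<open>nV\<close>; values outside \<open>V\<close> are irrelevant.
\<close>

definition bounded_linear_on ::
  "'a::real_vector set \<Rightarrow> ('a \<Rightarrow> real) \<Rightarrow> ('a \<Rightarrow> 'b::real_normed_vector) \<Rightarrow> bool" where
  "bounded_linear_on V nV K \<longleftrightarrow>
     (\<forall>x\<in>V. \<forall>y\<in>V. K (x + y) = K x + K y) \<and>
     (\<forall>c. \<forall>x\<in>V. K (c *\<^sub>R x) = c *\<^sub>R K x) \<and>
     (\<exists>C. \<forall>x\<in>V. norm (K x) \<le> C * nV x)"

definition onorm_on ::
  "'a set \<Rightarrow> ('a \<Rightarrow> real) \<Rightarrow> ('a \<Rightarrow> 'b::real_normed_vector) \<Rightarrow> real" where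
  "onorm_on V nV K = (SUP x\<in>V. norm (K x) / nV x)"


section \<open>The space $L^{3/2}$\<close>

definition in_L32 :: "'a measure \<Rightarrow> ('a \<Rightarrow> real) \<Rightarrow> bool" where
  "in_L32 M f \<longleftrightarrow> f \<in> borel_measurable M \<and> integrable M (\<lambda>z. \<bar>f z\<bar> powr (3/2))"

definition L32_norm :: "'a measure \<Rightarrow> ('a \<Rightarrow> real) \<Rightarrow> real" where
  "L32_norm M f = (\<integral>z. \<bar>f z\<bar> powr (3/2) \<partial>M) powr (2/3)"

lemma powr32_convex:
  fixes x y t s :: real
  assumes "x \<ge> 0" "y \<ge> 0" "s \<ge> 0" "t \<ge> 0" "s + t = 1"
  shows "(s * x + t * y) powr (3/2) \<le> s * x powr (3/2) + t * y powr (3/2)"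
proof -
  have aux: "c powr (3/2) \<le> c" if "0 \<le> c" "c \<le> 1" for c :: real
    using powr_mono'[of 1 "3/2" c] that by simp
  show ?thesis
  proof (cases "x = 0 \<or> y = 0")
    case True
    have "s \<le> 1" "t \<le> 1"
      using assms by auto
    then show ?thesis
      using True assms aux[of s] aux[of t]
      by (auto simp: powr_mult intro!: mult_right_mono)
  next
    case False
    moreover have "s = 1 - t" "t \<le> 1"
      using assms by auto
    ultimately show ?thesis
      using convex_onD[OF powr_convex[of "3/2"], of t x y] assms(1-4) by simp
  qed
qed

lemma L32_norm_ge0: "0 \<le> L32_norm M f"
  by (simp add: L32_norm_def)

lemma L32_norm_powr: "(L32_norm M f) powr (3/2) = (\<integral>z. \<bar>f z\<bar> powr (3/2) \<partial>M)"
  by (simp add: L32_norm_def powr_powr)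

lemma L32_norm_le:
  assumes "(\<integral>z. \<bar>f z\<bar> powr (3/2) \<partial>M) \<le> C powr (3/2)" "C \<ge> 0"
  shows "L32_norm M f \<le> C"
  using powr_mono2[OF _ _ assms(1), of "2/3"] assms(2)
  by (simp add: L32_norm_def powr_powr)

lemma in_L32_scale: "in_L32 M f \<Longrightarrow> in_L32 M (\<lambda>z. c * f z)"
  by (auto simp: in_L32_def abs_mult powr_mult)

lemma L32_norm_scale: "L32_norm M (\<lambda>z. c * f z) = \<bar>c\<bar> * L32_norm M f"
  by (simp add: L32_norm_def abs_mult powr_mult powr_powr)

lemma in_L32_zero: "in_L32 M (\<lambda>z. 0)"
  by (simp add: in_L32_def)

lemma in_L32_cong_AE:
  assumes "in_L32 M f" "g \<in> borel_measurable M" "AE z in M. f z = g z"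
  shows "in_L32 M g"
proof -
  have "integrable M (\<lambda>z. \<bar>g z\<bar> powr (3/2))"
    by (rule integrable_cong_AE_imp[where g = "\<lambda>z. \<bar>f z\<bar> powr (3/2)"])
       (use assms in \<open>auto simp: in_L32_def\<close>)
  with assms show ?thesis
    by (simp add: in_L32_def)
qed

lemma L32_norm_cong_AE:
  assumes "in_L32 M f" "in_L32 M g" "AE z in M. f z = g z"
  shows "L32_norm M f = L32_norm M g"
proof -
  have "(\<integral>z. \<bar>f z\<bar> powr (3/2) \<partial>M) = (\<integral>z. \<bar>g z\<bar> powr (3/2) \<partial>M)"
    by (rule integral_cong_AE) (use assms in \<open>auto simp: in_L32_def\<close>)
  then show ?thesis
    by (simp add: L32_norm_def)
qed

lemma L32_norm_eq_0_iff:
  assumes "in_L32 M f"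
  shows "L32_norm M f = 0 \<longleftrightarrow> (AE z in M. f z = 0)"
proof -
  have "L32_norm M f = 0 \<longleftrightarrow> (\<integral>z. \<bar>f z\<bar> powr (3/2) \<partial>M) = 0"
    by (simp add: L32_norm_def)
  also have "\<dots> \<longleftrightarrow> (AE z in M. \<bar>f z\<bar> powr (3/2) = 0)"
    by (rule integral_nonneg_eq_0_iff_AE) (use assms in \<open>auto simp: in_L32_def\<close>)
  finally show ?thesis
    by simp
qed

lemma L32_add_aux:
  assumes f: "in_L32 M f" and g: "in_L32 M g"
    and A: "A > 0" "L32_norm M f \<le> A" and B: "B > 0" "L32_norm M g \<le> B"
  shows "in_L32 M (\<lambda>z. f z + g z) \<and> L32_norm M (\<lambda>z. f z + g z) \<le> A + B"
proof -
  define s t where "s = A / (A + B)" and "t = B / (A + B)"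
  have st: "s \<ge> 0" "t \<ge> 0" "s + t = 1"
    using A B by (auto simp: s_def t_def add_divide_distrib[symmetric])
  define h where
    "h z = (A + B) powr (3/2) *
       (s * (\<bar>f z\<bar> powr (3/2) / A powr (3/2)) + t * (\<bar>g z\<bar> powr (3/2) / B powr (3/2)))" for z
  have bound: "\<bar>f z + g z\<bar> powr (3/2) \<le> h z" for z
  proof -
    have "\<bar>f z + g z\<bar> \<le> (A + B) * (s * (\<bar>f z\<bar> / A) + t * (\<bar>g z\<bar> / B))"
      using A B by (simp add: s_def t_def distrib_left)
    then have "\<bar>f z + g z\<bar> powr (3/2) \<le> ((A + B) * (s * (\<bar>f z\<bar> / A) + t * (\<bar>g z\<bar> / B))) powr (3/2)"
      by (intro powr_mono2) auto
    also have "\<dots> = (A + B) powr (3/2) * (s * (\<bar>f z\<bar> / A) + t * (\<bar>g z\<bar> / B)) powr (3/2)"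
      using A B st by (intro powr_mult) 
    also have "\<dots> \<le> h z"
      unfolding h_def
      using powr32_convex[of "\<bar>f z\<bar> / A" "\<bar>g z\<bar> / B" s t] A B st
      by (intro mult_left_mono) (auto simp: powr_divide)
    finally show ?thesis .
  qed
  have int_h: "integrable M h"
    using f g unfolding h_def in_L32_def by (intro integrable_mult_right Bochner_Integration.integrable_add) auto
  have meas: "(\<lambda>z. f z + g z) \<in> borel_measurable M"
    using f g by (auto simp: in_L32_def)
  then have int_sum: "integrable M (\<lambda>z. \<bar>f z + g z\<bar> powr (3/2))"
    by (intro Bochner_Integration.integrable_bound[OF int_h]) (use bound in \<open>auto intro: order_trans[OF _ abs_ge_self]\<close>)
  have "(\<integral>z. \<bar>f z + g z\<bar> powr (3/2) \<partial>M) \<le> (\<integral>z. h z \<partial>M)"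
    using int_sum int_h bound by (rule integral_mono)
  also have "(\<integral>z. h z \<partial>M) = (A + B) powr (3/2) *
      (s * (L32_norm M f powr (3/2) / A powr (3/2)) + t * (L32_norm M g powr (3/2) / B powr (3/2)))"
    using f g by (simp add: h_def L32_norm_powr in_L32_def)
  also have "\<dots> \<le> (A + B) powr (3/2) * (s * 1 + t * 1)"
    using A B st L32_norm_ge0[of M f] L32_norm_ge0[of M g]
    by (intro mult_left_mono add_mono) (auto intro!: powr_mono2)
  finally have "(\<integral>z. \<bar>f z + g z\<bar> powr (3/2) \<partial>M) \<le> (A + B) powr (3/2)"
    using st by simp
  then have "L32_norm M (\<lambda>z. f z + g z) \<le> A + B"
    using A B by (intro L32_norm_le) auto
  with meas int_sum show ?thesis
    by (simp add: in_L32_def)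
qed

lemma in_L32_add: "in_L32 M f \<Longrightarrow> in_L32 M g \<Longrightarrow> in_L32 M (\<lambda>z. f z + g z)"
  using L32_add_aux[of M f g "L32_norm M f + 1" "L32_norm M g + 1"] L32_norm_ge0[of M f] L32_norm_ge0[of M g]
  by auto

lemma L32_norm_triangle:
  assumes "in_L32 M f" "in_L32 M g"
  shows "L32_norm M (\<lambda>z. f z + g z) \<le> L32_norm M f + L32_norm M g"
proof (rule field_le_epsilon)
  fix e :: real
  assume "e > 0"
  then show "L32_norm M (\<lambda>z. f z + g z) \<le> L32_norm M f + L32_norm M g + e"
    using L32_add_aux[OF assms, of "L32_norm M f + e/2" "L32_norm M g + e/2"]
      L32_norm_ge0[of M f] L32_norm_ge0[of M g] by auto
qed


section \<open>The pressure space\<close>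

text \<open>
  \<open>cyl r\<close> is Lebesgue measure on $I \times B_r$, with $I = (-1,0)$. By Fubini and Tonelli,
  $L^{3/2}(I; L^{3/2}(B_r)) = L^{3/2}(I \times B_r)$ isometrically, and the latter is the
  form used here. The type \<open>yprs\<close> consists of the almost-everywhere classes for $r = 1/2$.
\<close>

definition cyl :: "real \<Rightarrow> (real \<times> (real^3)) measure" where
  "cyl r = lebesgue_on ({-1<..<0} \<times> ball 0 r)"

definition prs_rel :: "(real \<times> (real^3) \<Rightarrow> real) \<Rightarrow> (real \<times> (real^3) \<Rightarrow> real) \<Rightarrow> bool" where
  "prs_rel f g \<longleftrightarrow>
     in_L32 (cyl (1/2)) f \<and> in_L32 (cyl (1/2)) g \<and> (AE z in cyl (1/2). f z = g z)"

quotient_type yprs = "real \<times> (real^3) \<Rightarrow> real" / partial: prs_rel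
proof (rule part_equivpI)
  show "\<exists>f. prs_rel f f"
    by (rule exI[of _ "\<lambda>_. 0"]) (simp add: prs_rel_def in_L32_zero)
  show "symp prs_rel"
    by (auto simp: symp_def prs_rel_def elim: AE_mp)
  show "transp prs_rel"
    unfolding transp_def prs_rel_def by (auto elim: AE_mp)
qed

instantiation yprs :: real_normed_vector
begin

lift_definition zero_yprs :: yprs is "\<lambda>_. 0"
  by (simp add: prs_rel_def in_L32_zero)

lift_definition plus_yprs :: "yprs \<Rightarrow> yprs \<Rightarrow> yprs" is "\<lambda>f g z. f z + g z"
  unfolding prs_rel_def by (auto intro: in_L32_add elim: AE_mp)

lift_definition scaleR_yprs :: "real \<Rightarrow> yprs \<Rightarrow> yprs" is "\<lambda>c f z. c * f z"
  unfolding prs_rel_def by (auto intro: in_L32_scale elim: AE_mp)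

lift_definition uminus_yprs :: "yprs \<Rightarrow> yprs" is "\<lambda>f z. - f z"
  unfolding prs_rel_def using in_L32_scale[of _ _ "-1"] by (auto elim: AE_mp)

definition minus_yprs :: "yprs \<Rightarrow> yprs \<Rightarrow> yprs" where
  "minus_yprs x y = x + (- y)"

lift_definition norm_yprs :: "yprs \<Rightarrow> real" is "L32_norm (cyl (1/2))"
  unfolding prs_rel_def by (auto intro: L32_norm_cong_AE)

definition sgn_yprs :: "yprs \<Rightarrow> yprs" where
  "sgn_yprs x = inverse (norm x) *\<^sub>R x"

definition dist_yprs :: "yprs \<Rightarrow> yprs \<Rightarrow> real" where
  "dist_yprs x y = norm (x - y)"

definition uniformity_yprs :: "(yprs \<times> yprs) filter" where
  "uniformity_yprs = (INF e\<in>{0<..}. principal {(x, y). dist x y < e})"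

definition open_yprs :: "yprs set \<Rightarrow> bool" where
  "open_yprs S = (\<forall>x\<in>S. \<forall>\<^sub>F (x', y) in uniformity. x' = x \<longrightarrow> y \<in> S)"

instance
proof
  fix x y z :: yprs and a b :: real and S :: "yprs set"
  show "x + y + z = x + (y + z)"
    by transfer (auto simp: prs_rel_def add.assoc intro!: in_L32_add)
  show "x + y = y + x"
    by transfer (auto simp: prs_rel_def add.commute intro!: in_L32_add)
  show "0 + x = x"
    by transfer (auto simp: prs_rel_def)
  show "- x + x = 0"
    by transfer (auto simp: prs_rel_def in_L32_zero)
  show "x - y = x + - y"
    by (simp add: minus_yprs_def)
  show "a *\<^sub>R (x + y) = a *\<^sub>R x + a *\<^sub>R y"
    by transfer (auto simp: prs_rel_def distrib_left intro!: in_L32_add in_L32_scale)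
  show "(a + b) *\<^sub>R x = a *\<^sub>R x + b *\<^sub>R x"
    by transfer (auto simp: prs_rel_def distrib_right intro!: in_L32_add in_L32_scale)
  show "a *\<^sub>R b *\<^sub>R x = (a * b) *\<^sub>R x"
    by transfer (auto simp: prs_rel_def mult.assoc intro!: in_L32_scale)
  show "1 *\<^sub>R x = x"
    by transfer (auto simp: prs_rel_def)
  show "sgn x = inverse (norm x) *\<^sub>R x"
    by (rule sgn_yprs_def)
  show "dist x y = norm (x - y)"
    by (rule dist_yprs_def)
  show "uniformity = (INF e\<in>{0<..}. principal {(x, y :: yprs). dist x y < e})"
    by (rule uniformity_yprs_def)
  show "open S \<longleftrightarrow> (\<forall>x\<in>S. \<forall>\<^sub>F (x', y) in uniformity. x' = x \<longrightarrow> y \<in> S)"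
    by (rule open_yprs_def)
  show "norm x = 0 \<longleftrightarrow> x = 0"
    by transfer (auto simp: prs_rel_def in_L32_zero L32_norm_eq_0_iff)
  show "norm (x + y) \<le> norm x + norm y"
    by transfer (auto simp: prs_rel_def intro: L32_norm_triangle)
  show "norm (a *\<^sub>R x) = \<bar>a\<bar> * norm x"
    by transfer (simp add: L32_norm_scale)
qed

end

text \<open>
  \<open>prs_rel\<close> only looks at $I \times B_{1/2}$, so passing to the class includes the restriction.
  The default value 0 is never used below: double Riesz transforms of $L^{3/2}$ sources stay
  in $L^{3/2}$ by the Calderon-Zygmund theorem.
\<close>

definition to_yprs :: "(real \<times> (real^3) \<Rightarrow> real) \<Rightarrow> yprs" where
  "to_yprs f = (if in_L32 (cyl (1/2)) f then abs_yprs f else 0)"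

lemma norm_to_yprs:
  assumes "in_L32 (cyl (1/2)) f"
  shows "norm (to_yprs f) = L32_norm (cyl (1/2)) f"
  using assms by (simp add: to_yprs_def norm_yprs.abs_eq prs_rel_def)


section \<open>Riesz transforms\<close>

text \<open>
  Riesz transforms on $\mathbb R^3$ as principal-value integrals; the normalizing constant is
  $\Gamma(2)/\pi^2 = 1/\pi^2$. For $f \in L^p$, $1 < p < \infty$, the limit exists
  almost everywhere, and the value 0 is used on the exceptional null set.
\<close>

definition riesz_trunc :: "3 \<Rightarrow> real \<Rightarrow> (real^3 \<Rightarrow> real) \<Rightarrow> real^3 \<Rightarrow> real" where
  "riesz_trunc i e f x =
     1 / pi\<^sup>2 * (LINT y:{y. e < dist x y}|lebesgue. (x $ i - y $ i) / norm (x - y) ^ 4 * f y)"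

definition riesz :: "3 \<Rightarrow> (real^3 \<Rightarrow> real) \<Rightarrow> real^3 \<Rightarrow> real" where
  "riesz i f x =
     (if \<exists>l. ((\<lambda>e. riesz_trunc i e f x) \<longlongrightarrow> l) (at_right 0)
      then Lim (at_right 0) (\<lambda>e. riesz_trunc i e f x) else 0)"


section \<open>The enhanced-tail distance\<close>

text \<open>
  \<open>U\<close> and \<open>R\<close> send a package to (representatives of) its clean velocity and covariance,
  \<open>p\<close> to its harmonic pressure component; \<open>P\<close>, \<open>Q\<close>, \<open>J\<close> stand for
  $P^{\mathrm{cl}}_{\mathrm{prs},N}$, $\Pi_{\mathrm{harm},M}$, $J_{\mathrm{harm}}$.
\<close>

definition clean_source ::
  "('v pkg \<Rightarrow> real \<Rightarrow> real^3 \<Rightarrow> real^3) \<Rightarrow> ('v pkg \<Rightarrow> real \<Rightarrow> real^3 \<Rightarrow> real^3^3) \<Rightarrow>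
   'v pkg \<Rightarrow> 3 \<Rightarrow> 3 \<Rightarrow> real \<Rightarrow> real^3 \<Rightarrow> real" where
  "clean_source U R D i j t x = U D t x $ i * U D t x $ j + R D t x $ i $ j"

definition riesz_source ::
  "('v pkg \<Rightarrow> real \<Rightarrow> real^3 \<Rightarrow> real^3) \<Rightarrow> ('v pkg \<Rightarrow> real \<Rightarrow> real^3 \<Rightarrow> real^3^3) \<Rightarrow> 'v pkg \<Rightarrow> yprs" where
  "riesz_source U R D = to_yprs (\<lambda>(t, x). \<Sum>i\<in>UNIV. \<Sum>j\<in>UNIV.
     riesz i (riesz j (\<lambda>y. if y \<in> ball 0 1 then clean_source U R D i j t y else 0)) x)"

definition tail_proj ::
  "(yprs \<Rightarrow> yprs) \<Rightarrow> ('v::real_normed_vector pkg \<Rightarrow> real \<Rightarrow> real^3 \<Rightarrow> real^3) \<Rightarrow>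
   ('v pkg \<Rightarrow> real \<Rightarrow> real^3 \<Rightarrow> real^3^3) \<Rightarrow> 'v pkg \<Rightarrow> 'v pkg \<Rightarrow> real" where
  "tail_proj P U R D \<zeta> = (1 + onorm P) * norm (riesz_source U R (D - \<zeta>))"

definition tail_harm ::
  "('h::real_normed_vector \<Rightarrow> yprs) \<Rightarrow> ('h \<Rightarrow> 'h) \<Rightarrow> ('v::real_normed_vector pkg \<Rightarrow> 'h) \<Rightarrow>
   'v pkg \<Rightarrow> 'v pkg \<Rightarrow> real" where
  "tail_harm J Q p D \<zeta> = onorm J * norm (p (D - \<zeta>) - Q (p (D - \<zeta>)))"

definition tail_cost ::
  "int set \<Rightarrow> (nat \<Rightarrow> real) \<Rightarrow> real \<Rightarrow> real \<Rightarrow> (yprs \<Rightarrow> yprs) \<Rightarrow>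
   ('v::real_normed_vector pkg \<Rightarrow> real \<Rightarrow> real^3 \<Rightarrow> real^3) \<Rightarrow>
   ('v pkg \<Rightarrow> real \<Rightarrow> real^3 \<Rightarrow> real^3^3) \<Rightarrow>
   ('h::real_normed_vector \<Rightarrow> yprs) \<Rightarrow> ('h \<Rightarrow> 'h) \<Rightarrow> ('v pkg \<Rightarrow> 'h) \<Rightarrow>
   'v pkg \<Rightarrow> 'v pkg \<Rightarrow> real" where
  "tail_cost \<Lambda> a \<alpha>proj \<alpha>harm P U R J Q p D \<zeta> =
     loc_int_norm \<Lambda> a (D - \<zeta>) + \<alpha>proj * tail_proj P U R D \<zeta> + \<alpha>harm * tail_harm J Q p D \<zeta>"

definition tail_dist :: "('d \<Rightarrow> 'd \<Rightarrow> real) \<Rightarrow> 'd set \<Rightarrow> 'd \<Rightarrow> real" where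
  "tail_dist cost \<Gamma> D = (INF \<zeta>\<in>\<Gamma>. cost D \<zeta>)"

definition tail_selector ::
  "('d \<Rightarrow> 'd \<Rightarrow> real) \<Rightarrow> 'd set \<Rightarrow> 'd set \<Rightarrow> ('d \<Rightarrow> 'd) \<Rightarrow> real \<Rightarrow> bool" where
  "tail_selector cost V \<Gamma> \<zeta>s \<delta> \<longleftrightarrow>
     \<delta> \<ge> 0 \<and> (\<forall>D\<in>V. \<zeta>s D \<in> \<Gamma> \<and> cost D (\<zeta>s D) \<le> tail_dist cost \<Gamma> D + \<delta>)"

end

theory Submission
  imports Defs
begin

text \<open>
  The selected residual \<open>D - \<zeta>s D\<close> is again a package, and its norm is at most the full tail
  cost because the two tail terms are nonnegative. Each leakage operator is therefore
  controlled by its operator norm times the tail cost, which the selector bounds by the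
  tail distance plus \<open>\<delta>\<close>.
\<close>

lemma diff_in_packages:
  assumes "\<And>k j. k \<in> \<Lambda> \<Longrightarrow> j \<in> {1..7} \<Longrightarrow> subspace (X k j)"
    and "D \<in> packages \<Lambda> X" "E \<in> packages \<Lambda> X"
  shows "D - E \<in> packages \<Lambda> X"
  using assms by (auto simp: packages_def intro!: subspace_diff)

lemma loc_int_norm_nonneg:
  assumes "\<And>j. j \<in> {1..7} \<Longrightarrow> a j > 0"
  shows "0 \<le> loc_int_norm \<Lambda> a D"
  unfolding loc_int_norm_def
  using assms by (intro real_sqrt_ge_zero sum_nonneg mult_nonneg_nonneg) (auto intro: less_imp_le)

text \<open>A supremum of reals can be compared with its members only once the set is known to be
  bounded above; the constant from boundedness of \<open>K\<close> supplies such a bound.\<close>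

lemma bdd_above_onorm_on:
  assumes "bounded_linear_on V nV K" "\<And>x. x \<in> V \<Longrightarrow> 0 \<le> nV x"
  shows "bdd_above ((\<lambda>x. norm (K x) / nV x) ` V)"
proof -
  obtain C where C: "\<And>x. x \<in> V \<Longrightarrow> norm (K x) \<le> C * nV x"
    using assms(1) unfolding bounded_linear_on_def by blast
  \<comment> \<open>The absolute value covers points with \<open>nV x = 0\<close>: division by zero
    makes the quotient 0 there, while \<open>C\<close> could be negative if \<open>nV\<close>
    vanishes on all of \<open>V\<close>.\<close>
  have "norm (K x) / nV x \<le> \<bar>C\<bar>" if "x \<in> V" for x
  proof (cases "nV x = 0")
    case False
    then have "norm (K x) / nV x \<le> C"
      using C[OF that] assms(2)[OF that] by (simp add: divide_le_eq)
    then show ?thesis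
      by simp
  qed simp
  then show ?thesis
    by (rule bdd_aboveI2)
qed

lemma norm_le_onorm_on:
  assumes "bounded_linear_on V nV K" "\<And>x. x \<in> V \<Longrightarrow> 0 \<le> nV x" and x: "x \<in> V"
  shows "norm (K x) \<le> onorm_on V nV K * nV x"
proof (cases "nV x = 0")
  case True
  \<comment> \<open>The quotient carries no information here, but boundedness does:
    \<open>norm (K x)\<close> is at most a multiple of \<open>nV x = 0\<close>.\<close>
  then show ?thesis
    using assms(1) x by (force simp: bounded_linear_on_def)
next
  case False
  have "norm (K x) / nV x \<le> onorm_on V nV K"
    unfolding onorm_on_def using x bdd_above_onorm_on[OF assms(1,2)] by (rule cSUP_upper)
  then show ?thesis
    using False assms(2)[OF x] by (simp add: divide_le_eq)
qed

text \<open>Every quotient is nonnegative and lies below the supremum; the element \<open>x\<close>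
  guarantees that there is at least one.\<close>

lemma onorm_on_nonneg:
  assumes "bounded_linear_on V nV K" "\<And>x. x \<in> V \<Longrightarrow> 0 \<le> nV x" and "x \<in> V"
  shows "0 \<le> onorm_on V nV K"
proof -
  have "0 \<le> norm (K x) / nV x"
    using assms(2,3) by simp
  also have "\<dots> \<le> onorm_on V nV K"
    unfolding onorm_on_def using assms(3) bdd_above_onorm_on[OF assms(1,2)] by (rule cSUP_upper)
  finally show ?thesis .
qed

text \<open>Nonnegativity of the tail terms comes down to that of \<open>onorm P\<close> and
  \<open>onorm J\<close>, which bounded linearity provides.\<close>

lemma loc_int_norm_le_tail_cost:
  assumes "bounded_linear P" "bounded_linear J" "\<alpha>proj \<ge> 0" "\<alpha>harm \<ge> 0"
  shows "loc_int_norm \<Lambda> a (D - \<zeta>) \<le> tail_cost \<Lambda> a \<alpha>proj \<alpha>harm P U R J Q p D \<zeta>"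
  using assms by (simp add: tail_cost_def tail_proj_def tail_harm_def onorm_pos_le)

lemma tail_selector_exact:
  fixes cost :: "'d \<Rightarrow> 'd \<Rightarrow> real"
  assumes "\<And>D. D \<in> V \<Longrightarrow> is_arg_min (cost D) (\<lambda>\<zeta>. \<zeta> \<in> \<Gamma>) (\<zeta>s D)"
  shows "tail_selector cost V \<Gamma> \<zeta>s 0"
  unfolding tail_selector_def
proof (intro conjI ballI order_refl)
  fix D assume "D \<in> V"
  then have *: "\<zeta>s D \<in> \<Gamma>" "\<And>\<zeta>. \<zeta> \<in> \<Gamma> \<Longrightarrow> cost D (\<zeta>s D) \<le> cost D \<zeta>"
    using assms[of D] by (auto simp: is_arg_min_linorder)
  then show "\<zeta>s D \<in> \<Gamma>"
    by simp
  \<comment> \<open>The minimal value is a lower bound of all costs, hence at most their infimum;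
    \<open>\<zeta>s D\<close> itself shows that \<Gamma> is nonempty.\<close>
  have "cost D (\<zeta>s D) \<le> tail_dist cost \<Gamma> D"
    unfolding tail_dist_def using * by (intro cINF_greatest) auto
  then show "cost D (\<zeta>s D) \<le> tail_dist cost \<Gamma> D + 0"
    by simp
qed

theorem proposition9p123:
  fixes \<Lambda> :: "int set"
    and X :: "int \<Rightarrow> nat \<Rightarrow> 'v::real_normed_vector set"
    and a :: "nat \<Rightarrow> real"
    and \<Gamma> :: "'v pkg set"
    and U :: "'v pkg \<Rightarrow> real \<Rightarrow> real^3 \<Rightarrow> real^3"
    and R :: "'v pkg \<Rightarrow> real \<Rightarrow> real^3 \<Rightarrow> real^3^3"
    and p :: "'v pkg \<Rightarrow> 'h::real_normed_vector"
    and P :: "yprs \<Rightarrow> yprs"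
    and Q :: "'h \<Rightarrow> 'h"
    and J :: "'h \<Rightarrow> yprs"
    and \<alpha>proj \<alpha>harm \<delta> :: real
    and \<zeta>s :: "'v pkg \<Rightarrow> 'v pkg"
    and Ken :: "'v pkg \<Rightarrow> 'y1::real_normed_vector"
    and Kflux :: "'v pkg \<Rightarrow> 'y2::real_normed_vector"
    and Kprs :: "'v pkg \<Rightarrow> 'y3::real_normed_vector"
    and Kmom :: "'v pkg \<Rightarrow> 'y4::real_normed_vector"
    and V :: "'v pkg set"
    and nV :: "'v pkg \<Rightarrow> real"
    and cost :: "'v pkg \<Rightarrow> 'v pkg \<Rightarrow> real"
    and Rloc :: "'v pkg \<Rightarrow> real"
    and Cloc :: real
  assumes V_def: "V = packages \<Lambda> X"
    and nV_def: "nV = loc_int_norm \<Lambda> a"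
    and cost_def: "cost = tail_cost \<Lambda> a \<alpha>proj \<alpha>harm P U R J Q p"
    and Rloc_def: "Rloc = (\<lambda>D. norm (Ken (D - \<zeta>s D)) + norm (Kflux (D - \<zeta>s D)) +
                             norm (Kprs (D - \<zeta>s D)) + norm (Kmom (D - \<zeta>s D)))"
    and Cloc_def: "Cloc = onorm_on V nV Ken + onorm_on V nV Kflux +
                          onorm_on V nV Kprs + onorm_on V nV Kmom"
    and \<Lambda>: "\<exists>m n. \<Lambda> = {m..n}"
    and X: "\<And>k j. k \<in> \<Lambda> \<Longrightarrow> j \<in> {1..7} \<Longrightarrow> subspace (X k j)"
    and a: "\<And>j. j \<in> {1..7} \<Longrightarrow> a j > 0"
    and \<Gamma>: "\<Gamma> \<subseteq> V" "subspace \<Gamma>"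
    and source: "\<And>D i j. D \<in> V \<Longrightarrow> in_L32 (cyl 1) (\<lambda>(t, x). clean_source U R D i j t x)"
    and P: "bounded_linear P" "\<And>y. P (P y) = P y"
    and Q: "bounded_linear Q" "\<And>y. Q (Q y) = Q y" "\<exists>B. finite B \<and> range Q = span B"
    and J: "bounded_linear J"
    and \<alpha>: "\<alpha>proj > 0" "\<alpha>harm > 0"
    and selector: "tail_selector cost V \<Gamma> \<zeta>s \<delta>"
    and fin_dim: "\<exists>B :: 'y1 set. finite B \<and> span B = UNIV"
      "\<exists>B :: 'y2 set. finite B \<and> span B = UNIV"
      "\<exists>B :: 'y3 set. finite B \<and> span B = UNIV"
      "\<exists>B :: 'y4 set. finite B \<and> span B = UNIV"
    and K: "bounded_linear_on V nV Ken" "bounded_linear_on V nV Kflux"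
      "bounded_linear_on V nV Kprs" "bounded_linear_on V nV Kmom"
  shows "(\<forall>D\<in>V. Rloc D \<le> Cloc * tail_dist cost \<Gamma> D + Cloc * \<delta>) \<and>
    ((\<forall>D\<in>V. is_arg_min (cost D) (\<lambda>\<zeta>. \<zeta> \<in> \<Gamma>) (\<zeta>s D)) \<longrightarrow>
       tail_selector cost V \<Gamma> \<zeta>s 0 \<and>
       (\<forall>D\<in>V. Rloc D \<le> Cloc * tail_dist cost \<Gamma> D))"
proof -
  have nonneg: "0 \<le> nV D" for D
    unfolding nV_def using a by (rule loc_int_norm_nonneg)
  note onorm_bound = norm_le_onorm_on[OF _ nonneg] and onorm_nonneg = onorm_on_nonneg[of V nV, OF _ nonneg]
  \<comment> \<open>The selector error is kept general so that the estimate serves both for \<delta>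
    and, with an exact minimizer, for 0.\<close>
  have bound: "Rloc D \<le> Cloc * tail_dist cost \<Gamma> D + Cloc * \<epsilon>"
    if sel: "tail_selector cost V \<Gamma> \<zeta>s \<epsilon>" and D: "D \<in> V" for D \<epsilon>
  proof -
    let ?E = "D - \<zeta>s D"
    have "\<zeta>s D \<in> \<Gamma>" and sel_D: "cost D (\<zeta>s D) \<le> tail_dist cost \<Gamma> D + \<epsilon>"
      using sel D by (auto simp: tail_selector_def)
    then have E: "?E \<in> V"
      using D \<Gamma>(1) X unfolding V_def by (intro diff_in_packages) auto
    have "nV ?E \<le> cost D (\<zeta>s D)"
      unfolding nV_def cost_def using P(1) J \<alpha> by (intro loc_int_norm_le_tail_cost) auto
    with sel_D have nV_E: "nV ?E \<le> tail_dist cost \<Gamma> D + \<epsilon>"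
      by simp
    have "Rloc D \<le> Cloc * nV ?E"
      unfolding Rloc_def Cloc_def distrib_right
      by (intro add_mono onorm_bound K E)
    \<comment> \<open>Monotonicity needs \<open>Cloc\<close> to be nonnegative; the residual
      \<open>?E\<close> is the element of \<open>V\<close> that makes each operator norm a supremum
      over a nonempty set.\<close>
    also have "\<dots> \<le> Cloc * (tail_dist cost \<Gamma> D + \<epsilon>)"
      unfolding Cloc_def using nV_E
      by (rule mult_left_mono) (intro add_nonneg_nonneg onorm_nonneg[OF _ E] K)
    finally show ?thesis
      by (simp add: distrib_left)
  qed
  show ?thesis
    using bound[OF selector] tail_selector_exact[of V cost \<Gamma> \<zeta>s] bound[of 0] by auto
qed

end
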